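(* Let $M$ be a paving matroid with $\gamma(M) = \beta(E(M))$. Then $M$ is cyclically orderable.
   Context: A matroid $M$ of rank $r$ is a paving matroid if every circuit of $M$ has at least $r$ elements. $M$ is cyclically orderable if there is a cyclic ordering (cyclic permutation) of $E(M)$ such that any $r$ cyclically consecutive elements form a basis of $M$. For $\emptyset \ne X \subseteq E(M)$, $\beta(X) := |X|/r(X)$ if $r(X) \neq 0$ and $\beta(X) := \infty$ if $r(X)=0$; and $\gamma(M) := \max_{\emptyset \ne X \subseteq E(M)} \beta(X)$. *)

theory Defs
  imports Main "HOL-Library.Extended_Real"
begin

definition matroid :: "'a set \<Rightarrow> ('a set \<Rightarrow> bool) \<Rightarrow> bool" where
  "matroid E indep \<longleftrightarrow>
     finite E \<and>
     (\<forall>X. indep X \<longrightarrow> X \<subseteq> E) \<and>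
     indep {} \<and>
     (\<forall>X Y. indep X \<and> Y \<subseteq> X \<longrightarrow> indep Y) \<and>
     (\<forall>X Y. indep X \<and> indep Y \<and> card X < card Y \<longrightarrow>
        (\<exists>y \<in> Y - X. indep (insert y X)))"

definition mrank :: "('a set \<Rightarrow> bool) \<Rightarrow> 'a set \<Rightarrow> nat" where
  "mrank indep X = Max {card I | I. I \<subseteq> X \<and> indep I}"

definition basis :: "('a set \<Rightarrow> bool) \<Rightarrow> 'a set \<Rightarrow> bool" where
  "basis indep B \<longleftrightarrow> indep B \<and> (\<forall>B'. indep B' \<and> B \<subseteq> B' \<longrightarrow> B' = B)"

definition circuit :: "'a set \<Rightarrow> ('a set \<Rightarrow> bool) \<Rightarrow> 'a set \<Rightarrow> bool" where
  "circuit E indep C \<longleftrightarrow> C \<subseteq> E \<and> \<not> indep C \<and> (\<forall>D. D \<subset> C \<longrightarrow> indep D)"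

definition paving :: "'a set \<Rightarrow> ('a set \<Rightarrow> bool) \<Rightarrow> bool" where
  "paving E indep \<longleftrightarrow> (\<forall>C. circuit E indep C \<longrightarrow> card C \<ge> mrank indep E)"

definition cyclically_orderable :: "'a set \<Rightarrow> ('a set \<Rightarrow> bool) \<Rightarrow> bool" where
  "cyclically_orderable E indep \<longleftrightarrow>
     (\<exists>\<sigma>. bij_betw \<sigma> {0..<card E} E \<and>
        (\<forall>i < card E. basis indep ((\<lambda>j. \<sigma> ((i + j) mod card E)) ` {0..<mrank indep E})))"

definition beta :: "('a set \<Rightarrow> bool) \<Rightarrow> 'a set \<Rightarrow> ereal" where
  "beta indep X = (if mrank indep X = 0 then \<infinity>
                   else ereal (real (card X) / real (mrank indep X)))"

definition gamma :: "'a set \<Rightarrow> ('a set \<Rightarrow> bool) \<Rightarrow> ereal" where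
  "gamma E indep = Max {beta indep X | X. X \<noteq> {} \<and> X \<subseteq> E}"

end

theory Submission
  imports Defs
begin

text \<open>In a paving matroid of rank \<open>r \<ge> 2\<close> an \<open>r\<close>-set is a basis iff no hyperplane contains it, and
  every \<open>(r - 1)\<close>-set lies in exactly one hyperplane; the density condition says
  \<open>card E \<le> r * card (E - H)\<close> for every hyperplane \<open>H\<close>. If \<open>card E \<ge> 2 * r\<close>, a basis \<open>S\<close> minimizing
  the largest \<open>card (H - S)\<close> leaves a set \<open>E - S\<close> with the same density condition (up to one
  exceptional case), which has a suitable cyclic ordering by induction. This ordering is cut open and the
  elements of \<open>S\<close> are inserted greedily: at each step the windows ending in \<open>S\<close> exclude the elements of one
  hyperplane, the windows starting in \<open>S\<close> at most one element more, and a suitable choice of the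
  cut keeps the process from getting stuck. If \<open>r < card E < 2 * r - 1\<close>, the same insertion is applied
  to a block of \<open>card E - r + 1\<close> elements.\<close>

section \<open>Families of hyperplanes\<close>

text \<open>Windows of the doubled list cross the cyclic seam without a case split; this is the link
  to the indices modulo \<open>card E\<close> in \<open>cyclically_orderable\<close>.\<close>

lemma take_drop_double:
  assumes "i < length xs" "r \<le> length xs"
  shows "take r (drop i (xs @ xs)) = map (\<lambda>t. xs ! ((i + t) mod length xs)) [0..<r]"
proof (rule nth_equalityI)
  fix t assume "t < length (take r (drop i (xs @ xs)))"
  then have "t < r" using assms by auto
  then show "take r (drop i (xs @ xs)) ! t = map (\<lambda>t. xs ! ((i + t) mod length xs)) [0..<r] ! t"
    using assms by (auto simp: nth_append less_diff_conv not_less le_mod_geq add.commute)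
qed (use assms in auto)

text \<open>\<open>hyp_eqI\<close> captures that in a paving matroid \<open>r - 1\<close> elements
  determine the hyperplane through them. No ground set is fixed, so one family serves for all
  subsets met in the induction. Infinite sets have \<open>card\<close> 0, hence
  \<open>2 \<le> r\<close> makes \<open>A\<close> finite.\<close>

locale hyperplanes =
  fixes \<H> :: "'a set set" and r :: nat
  assumes hyp_eqI: "\<lbrakk>H \<in> \<H>; H' \<in> \<H>; A \<subseteq> H; A \<subseteq> H'; r \<le> Suc (card A)\<rbrakk> \<Longrightarrow> H = H'"
    and r_ge2: "2 \<le> r"
begin

text \<open>Plays the role of spanning: closed upwards, and for an \<open>r\<close>-subset of the
  ground set the same as being a basis.\<close>

definition good :: "'a set \<Rightarrow> bool" where
  "good X \<longleftrightarrow> (\<forall>H\<in>\<H>. \<not> X \<subseteq> H)"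

definition lin_good :: "'a list \<Rightarrow> bool" where
  "lin_good xs \<longleftrightarrow> (\<forall>i. i + r \<le> length xs \<longrightarrow> good (set (take r (drop i xs))))"

definition cyc_good :: "'a list \<Rightarrow> bool" where
  "cyc_good xs \<longleftrightarrow> (\<forall>i<length xs. good (set (take r (drop i (xs @ xs)))))"

lemma goodI: "(\<And>H. H \<in> \<H> \<Longrightarrow> X \<subseteq> H \<Longrightarrow> False) \<Longrightarrow> good X"
  by (auto simp: good_def)

lemma good_mono: "good X \<Longrightarrow> X \<subseteq> Y \<Longrightarrow> good Y"
  by (auto simp: good_def)

lemma goodD: "good X \<Longrightarrow> H \<in> \<H> \<Longrightarrow> \<not> X \<subseteq> H"
  by (auto simp: good_def)

lemma not_goodE:
  assumes "\<not> good X" obtains H where "H \<in> \<H>" "X \<subseteq> H"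
  using assms by (auto simp: good_def)

text \<open>Hyperplanes through the two exchanged sets share the \<open>r - 1\<close> elements of
  \<open>S - {s, s'}\<close> and \<open>e\<close>, so they coincide and contain \<open>S\<close>. In
  matroid terms, the fundamental circuit of \<open>e\<close> misses at most one element of
  \<open>S\<close>.\<close>

lemma basis_exchange_unique:
  assumes S: "good S" "card S = r" and s: "s \<in> S" "s' \<in> S" "s \<noteq> s'" and e: "e \<notin> S"
  shows "good (insert e (S - {s})) \<or> good (insert e (S - {s'}))"
proof (rule ccontr)
  assume bad: "\<not> ?thesis"
  have "finite S" using S r_ge2 by (intro card_ge_0_finite) simp
  obtain H where H: "H \<in> \<H>" "insert e (S - {s}) \<subseteq> H" using bad not_goodE by metis
  obtain H' where H': "H' \<in> \<H>" "insert e (S - {s'}) \<subseteq> H'" using bad not_goodE by metis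
  have "card (insert e (S - {s,s'})) = r - 1"
    using s e S \<open>finite S\<close> r_ge2 by (simp add: card_Diff_subset)
  then have "H = H'" using H H' by (intro hyp_eqI[of H H' "insert e (S - {s,s'})"]) auto
  then show False using goodD[OF S(1) H(1)] H H' s by blast
qed

text \<open>All hyperplanes through the \<open>r - 1\<close> elements of \<open>S - {a}\<close>
  coincide, so the obstructions for the single elements of \<open>D\<close> merge into one.\<close>

lemma basis_hyperplane:
  assumes S: "card S = r" "a \<in> S" and D: "D \<noteq> {}" "\<And>e. e \<in> D \<Longrightarrow> \<not> good (insert e (S - {a}))"
  obtains H where "H \<in> \<H>" "(S - {a}) \<union> D \<subseteq> H"
proof -
  have card: "card (S - {a}) = r - 1" using S by simp
  obtain e0 where "e0 \<in> D" using D by auto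
  then obtain H where H: "H \<in> \<H>" "insert e0 (S - {a}) \<subseteq> H" using D(2) by (auto simp: good_def)
  have "e \<in> H" if e: "e \<in> D" for e
  proof -
    obtain H' where "H' \<in> \<H>" "insert e (S - {a}) \<subseteq> H'" using D(2)[OF e] by (rule not_goodE)
    then show ?thesis using H card hyp_eqI[of H H' "S - {a}"] by auto
  qed
  then show ?thesis using H that by auto
qed

text \<open>Cutting a cyclic ordering open at any place keeps a part of its windows.\<close>

lemma lin_good_rotate:
  assumes "cyc_good xs" shows "lin_good (rotate j xs)"
  unfolding lin_good_def
proof (intro allI impI)
  fix i assume i: "i + r \<le> length (rotate j xs)"
  let ?m = "length xs" and ?i = "(i + j) mod length xs"
  have m: "0 < ?m" using i r_ge2 by auto
  have "take r (drop i (rotate j xs)) = map (\<lambda>t. xs ! ((?i + t) mod ?m)) [0..<r]"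
  proof (rule nth_equalityI)
    fix t assume "t < length (take r (drop i (rotate j xs)))"
    then have "t < r" "i + t < ?m" using i by auto
    then show "take r (drop i (rotate j xs)) ! t = map (\<lambda>t. xs ! ((?i + t) mod ?m)) [0..<r] ! t"
      by (simp add: nth_rotate mod_simps add.assoc add.commute add.left_commute)
  qed (use i in auto)
  also have "\<dots> = take r (drop ?i (xs @ xs))"
    using i m by (subst take_drop_double) auto
  finally show "good (set (take r (drop i (rotate j xs))))"
    using assms m by (simp add: cyc_good_def)
qed

end

section \<open>Inserting a block\<close>

text \<open>\<open>S\<close> is to follow \<open>es\<close> on the circle as one run.
  \<open>lin\<close> covers the windows inside \<open>es\<close>, and \<open>wrap\<close> those
  containing all of \<open>S\<close>, which do not depend on the order within \<open>S\<close>. By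
  \<open>length_es\<close> no window leaves the block and enters it again.\<close>

locale block = hyperplanes \<H> r for \<H> :: "'a set set" and r +
  fixes es :: "'a list" and S :: "'a set"
  assumes distinct_es: "distinct es" and finite_S: "finite S" and disj: "S \<inter> set es = {}"
    and card_S_pos: "0 < card S" and card_S_le: "card S \<le> r" and length_es: "r \<le> Suc (length es)"
    and lin: "lin_good es"
    and wrap: "\<And>j. j \<le> r - card S \<Longrightarrow>
        good (S \<union> set (take j es) \<union> set (drop (length es - (r - card S - j)) es))"
begin

text \<open>\<open>pre i\<close> completes the first \<open>i\<close> block elements to the window
  ending with them; \<open>post i\<close> completes the other \<open>card S - i\<close> block
  elements to the window starting with them.\<close>

abbreviation pre :: "nat \<Rightarrow> 'a set" where "pre i \<equiv> set (drop (length es - (r - i)) es)"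
abbreviation post :: "nat \<Rightarrow> 'a set" where "post i \<equiv> set (take (r - card S + i) es)"

text \<open>The two windows at the cut between \<open>T\<close> and \<open>S - T\<close> depend on
  \<open>T\<close> only as a set, which makes a greedy choice possible. At \<open>T = {}\<close> and
  \<open>T = S\<close> one of them would contain no block element and is left out.\<close>

definition ok :: "'a set \<Rightarrow> bool" where
  "ok T \<longleftrightarrow> (T \<noteq> {} \<longrightarrow> good (T \<union> pre (card T))) \<and> (T \<noteq> S \<longrightarrow> good ((S - T) \<union> post (card T)))"

lemma card_pre: "0 < i \<Longrightarrow> card (pre i) = r - i"
  using length_es distinct_es by (simp add: distinct_card)

lemma card_post: "i < card S \<Longrightarrow> card (post i) = r - card S + i"
  using length_es distinct_es card_S_le by (simp add: distinct_card)

lemma pre_antimono: "i \<le> j \<Longrightarrow> pre j \<subseteq> pre i"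
  by (intro set_drop_subset_set_drop) auto

lemma post_mono: "i \<le> j \<Longrightarrow> post i \<subseteq> post j"
  by (intro set_take_subset_set_take) auto

lemma pre_disj: "T \<subseteq> S \<Longrightarrow> T \<inter> pre i = {}"
  using disj set_drop_subset by fast

lemma post_disj: "T \<subseteq> S \<Longrightarrow> T \<inter> post i = {}"
  using disj set_take_subset by fast

lemma card_Un_pre: "T \<subseteq> S \<Longrightarrow> 0 < i \<Longrightarrow> card (T \<union> pre i) = card T + (r - i)"
  using finite_S by (subst card_Un_disjoint) (auto simp: card_pre pre_disj dest: finite_subset)

lemma card_Un_post: "T \<subseteq> S \<Longrightarrow> i < card S \<Longrightarrow> card (T \<union> post i) = card T + (r - card S + i)"
  using finite_S by (subst card_Un_disjoint) (auto simp: card_post post_disj dest: finite_subset)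

lemma ok_S: "ok S"
  using wrap[of 0] by (simp add: ok_def)

lemma ok_empty: "ok {}"
  using wrap[of "r - card S"] by (simp add: ok_def)

text \<open>The two obstructing hyperplanes share \<open>r - 1\<close> elements, hence coincide, and
  then contain the rear window of \<open>T\<close>, which is good by \<open>ok T\<close>.\<close>

lemma back_unique:
  assumes T: "T \<subseteq> S" "ok T" and s: "s \<in> S - T" "s' \<in> S - T" "s \<noteq> s'"
    and bad: "\<not> good ((S - insert s T) \<union> post (Suc (card T)))"
      "\<not> good ((S - insert s' T) \<union> post (Suc (card T)))"
  shows False
proof -
  obtain H where H: "H \<in> \<H>" "(S - insert s T) \<union> post (Suc (card T)) \<subseteq> H" using bad not_goodE by metis
  obtain H' where H': "H' \<in> \<H>" "(S - insert s' T) \<union> post (Suc (card T)) \<subseteq> H'" using bad not_goodE by metis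
  let ?X = "(S - T - {s,s'}) \<union> post (Suc (card T))"
  have fT: "finite T" using T finite_S finite_subset by blast
  have "card (T \<union> {s,s'}) \<le> card S" using T s finite_S by (intro card_mono) auto
  moreover have "card (T \<union> {s,s'}) = card T + 2" using s fT by simp
  ultimately have le: "card T + 2 \<le> card S" by simp
  have "card (S - T - {s,s'}) = card S - card T - 2"
    using T s fT by (simp add: card_Diff_subset)
  then have "card ?X = r - 1"
    using le card_S_le by (subst card_Un_post) auto
  then have "H = H'" using H H' by (intro hyp_eqI[of H H' ?X]) auto
  then have "S - T \<subseteq> H" using H(2) H'(2) s(3) by auto
  moreover have "post (card T) \<subseteq> H" using H(2) post_mono[of "card T" "Suc (card T)"] by auto
  ultimately show False using T s H by (auto simp: ok_def good_def)
qed

text \<open>The elements that may not follow \<open>T\<close> because of the window ending in the block lie in a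
  single hyperplane; windows starting in the block exclude at most one further element.\<close>

lemma ok_extend:
  assumes T: "T \<subset> S" "ok T" and live: "\<And>s. s \<in> S - T \<Longrightarrow> good ((S - {s}) \<union> pre (card S - 1))"
  shows "\<exists>s\<in>S - T. ok (insert s T)"
proof -
  have fT: "finite T" using T finite_S finite_subset by blast
  have lt: "card T < card S" using T finite_S psubset_card_mono by blast
  show ?thesis
  proof (cases "Suc (card T) = card S")
    case True
    then have "card (S - T) = 1" using T fT by (simp add: card_Diff_subset)
    then obtain s where "S - T = {s}" by (auto simp: card_1_singleton_iff)
    then have "insert s T = S" using T by auto
    then show ?thesis using ok_S \<open>S - T = {s}\<close> by auto
  next
    case False
    then have lt2: "Suc (card T) \<le> card S - 1" using lt by linarith
    let ?front = "\<lambda>s. good (insert s T \<union> pre (Suc (card T)))"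
    \<comment> \<open>Two candidates with a good front window suffice, because
      \<open>back_unique\<close> excludes at most one of them.\<close>
    have "\<exists>s\<in>S-T. \<exists>s'\<in>S-T. s \<noteq> s' \<and> ?front s \<and> ?front s'"
    proof (cases "\<exists>H\<in>\<H>. T \<union> pre (Suc (card T)) \<subseteq> H")
      case True
      then obtain H where H: "H \<in> \<H>" "T \<union> pre (Suc (card T)) \<subseteq> H" by blast
      have pre: "pre (card S - 1) \<subseteq> H" using H pre_antimono[OF lt2] by blast
      have front: "?front s" if "s \<notin> H" for s
      proof (rule goodI)
        fix H' assume H': "H' \<in> \<H>" "insert s T \<union> pre (Suc (card T)) \<subseteq> H'"
        have "r \<le> Suc (card (T \<union> pre (Suc (card T))))"
          using T lt card_S_le by (subst card_Un_pre) auto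
        then have "H = H'" using H H' by (intro hyp_eqI) auto
        then show False using that H' by auto
      qed
      obtain s0 where "s0 \<in> S - T" using T by auto
      \<comment> \<open>\<open>H\<close> contains \<open>T\<close> and
        \<open>pre (card S - 1)\<close>, so by \<open>live\<close> it misses some \<open>s1\<close>
        in \<open>S - {s0}\<close>, and then also some \<open>s2\<close> in
        \<open>S - {s1}\<close>.\<close>
      from goodD[OF live[OF this] H(1)] pre H obtain s1 where s1: "s1 \<in> S - T" "s1 \<notin> H" by auto
      from goodD[OF live[OF s1(1)] H(1)] pre H obtain s2 where "s2 \<in> S - T" "s2 \<notin> H" "s2 \<noteq> s1" by auto
      then show ?thesis using s1 front by blast
    next
      case False
      then have "?front s" for s by (auto simp: good_def)
      moreover have "2 \<le> card (S - T)" using T fT lt2 by (simp add: card_Diff_subset)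
      then have "\<not> (\<forall>x\<in>S-T. \<forall>y\<in>S-T. x = y)" using finite_S card_le_Suc0_iff_eq[of "S - T"] by auto
      ultimately show ?thesis by blast
    qed
    then obtain s s' where s: "s \<in> S - T" "s' \<in> S - T" "s \<noteq> s'" "?front s" "?front s'" by blast
    have "good ((S - insert s T) \<union> post (Suc (card T))) \<or> good ((S - insert s' T) \<union> post (Suc (card T)))"
      using back_unique[of T s s'] T s by blast
    then show ?thesis using s fT unfolding ok_def by auto
  qed
qed

text \<open>The greedy extension uses \<open>live\<close> only for elements not yet placed; elements
  violating it can be put into the prefix \<open>p\<close> beforehand.\<close>

lemma ok_complete:
  assumes "distinct p" "set p \<subseteq> S" "\<And>i. i \<le> length p \<Longrightarrow> ok (set (take i p))"
    and live: "\<And>s. s \<in> S - set p \<Longrightarrow> good ((S - {s}) \<union> pre (card S - 1))"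
  shows "\<exists>ss. distinct ss \<and> set ss = S \<and> (\<forall>i\<le>card S. ok (set (take i ss)))"
  using assms
proof (induction "card S - length p" arbitrary: p rule: less_induct)
  case less
  show ?case
  proof (cases "set p = S")
    case True
    then have "length p = card S" using less.prems(1) distinct_card by metis
    then show ?thesis using True less.prems(1,3) by (intro exI[of _ p]) auto
  next
    case False
    then have "set p \<subset> S" "ok (set p)"
      using less.prems(2) less.prems(3)[of "length p"] by auto
    then obtain s where s: "s \<in> S - set p" "ok (insert s (set p))"
      using ok_extend less.prems(4) by blast
    have "length p < card S"
      using psubset_card_mono[OF finite_S, of "set p"] False less.prems(1,2) distinct_card[of p] by auto
    moreover have "ok (set (take i (p @ [s])))" if "i \<le> length (p @ [s])" for i
      using that s less.prems(3)[of i] by (cases "i = Suc (length p)") auto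
    ultimately show ?thesis
      using s less.prems(1,2,4) by (intro less.hyps[of "p @ [s]"]) auto
  qed
qed

lemma cyc_good_append:
  assumes ss: "distinct ss" "set ss = S" "\<And>i. i \<le> card S \<Longrightarrow> ok (set (take i ss))"
  shows "cyc_good (es @ ss)"
  unfolding cyc_good_def
proof (intro allI impI)
  let ?m = "length es" and ?k = "card S"
  have len: "length ss = ?k" using ss distinct_card by metis
  have card_take: "i \<le> ?k \<Longrightarrow> card (set (take i ss)) = i" for i
    using ss len by (simp add: distinct_card)
  have front: "good (set (take i ss) \<union> pre i)" if "0 < i" "i \<le> ?k" for i
  proof -
    have "set (take i ss) \<noteq> {}" using that len by auto
    then show ?thesis using ss(3)[of i] that card_take[of i] by (simp add: ok_def)
  qed
  have rear: "good (set (drop i ss) \<union> post i)" if "i < ?k" for i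
  proof -
    have "set (take i ss) \<inter> set (drop i ss) = {}" by (simp add: ss(1) set_take_disj_set_drop_if_distinct)
    moreover have "set (take i ss) \<union> set (drop i ss) = S"
      using ss(2) by (metis append_take_drop_id set_append)
    ultimately have "S - set (take i ss) = set (drop i ss)" by blast
    moreover have "set (take i ss) \<noteq> S"
    proof
      assume "set (take i ss) = S"
      then show False using card_take[of i] that by simp
    qed
    ultimately show ?thesis using ss(3)[of i] that card_take[of i] by (simp add: ok_def)
  qed
  fix i assume i: "i < length (es @ ss)"
  show "good (set (take r (drop i ((es @ ss) @ es @ ss))))"
  proof (cases "i \<le> ?m")
    case True
    \<comment> \<open>The window lies inside \<open>es\<close>, ends in the block, or contains the
      whole block and continues at the start of \<open>es\<close>.\<close>
    consider "i + r \<le> ?m" | "?m < i + r" "i + r \<le> ?m + ?k" | "?m + ?k < i + r" by linarith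
    then show ?thesis
    proof cases
      case 1
      then show ?thesis using lin True by (simp add: lin_good_def)
    next
      case 2
      then show ?thesis using True front[of "i + r - ?m"] len by (simp add: Un_commute add.commute)
    next
      case 3
      have "good (S \<union> set (take (r - ?k - (?m - i)) es) \<union> set (drop i es))"
        using wrap[of "r - ?k - (?m - i)"] 3 True card_S_le by simp
      then show ?thesis
        using 3 True len ss(2) card_S_pos length_es by (simp add: Un_ac diff_right_commute add.commute)
    qed
  next
    case False
    then have "i - ?m < ?k" using i len by simp
    then show ?thesis using False rear[of "i - ?m"] len card_S_le length_es i
      by (simp add: algebra_simps)
  qed
qed

lemma cyc_good_exists:
  assumes "distinct p" "set p \<subseteq> S" "\<And>i. i \<le> length p \<Longrightarrow> ok (set (take i p))"
    and "\<And>s. s \<in> S - set p \<Longrightarrow> good ((S - {s}) \<union> pre (card S - 1))"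
  shows "\<exists>xs. distinct xs \<and> set xs = S \<union> set es \<and> cyc_good xs"
proof -
  obtain ss where ss: "distinct ss" "set ss = S" "\<forall>i\<le>card S. ok (set (take i ss))"
    using ok_complete[OF assms] by blast
  then show ?thesis
    using cyc_good_append[of ss] distinct_es disj by (intro exI[of _ "es @ ss"]) auto
qed

text \<open>A block that is a basis. If the last \<open>r - 1\<close> elements of \<open>es\<close> all have a fundamental circuit
  avoiding some element of the block, a hyperplane through them and \<open>a\<close> would contain too few
  elements of the block, by pigeonhole on these avoided elements.\<close>

lemma cyc_good_basis_block:
  assumes k: "card S = r"
    and ends: "(\<forall>s\<in>S. good (insert (last es) (S - {s}))) \<or>
      (\<exists>a\<in>S. \<not> good (insert (last es) (S - {a})) \<and> good (insert (hd es) (S - {a})) \<and>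
        (\<forall>e\<in>pre 1. \<exists>s\<in>S. \<not> good (insert e (S - {s}))))"
  shows "\<exists>xs. distinct xs \<and> set xs = S \<union> set es \<and> cyc_good xs"
proof -
  have ne: "es \<noteq> []" using length_es r_ge2 by auto
  \<comment> \<open>As \<open>card S = r\<close>, the condition \<open>live\<close> involves only
    the last element of \<open>es\<close>, and the rear window after one block element only the
    head.\<close>
  have pre_last: "pre (r - 1) = {last es}"
  proof -
    have "drop (length es - 1) es = [last es]"
      by (metis append_butlast_last_id append_eq_conv_conj length_butlast ne)
    then show ?thesis using r_ge2 by simp
  qed
  have post_hd: "post 1 = {hd es}" using k ne by (cases es) auto
  have goodS: "good S" using wrap[of 0] k by simp
  have same: "H = H'" if "H \<in> \<H>" "H' \<in> \<H>" "s \<in> S" "S - {s} \<subseteq> H" "S - {s} \<subseteq> H'" for H H' s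
    using that k finite_S by (intro hyp_eqI[of H H' "S - {s}"]) auto
  have live: "good (insert e (S - {s'}))"
    if "\<not> good (insert e (S - {s}))" "s \<in> S" "s' \<in> S" "s' \<noteq> s" "e \<notin> S" for e s s'
    using basis_exchange_unique[OF goodS k, of s s' e] that by blast
  show ?thesis
  proof (cases "\<forall>s\<in>S. good (insert (last es) (S - {s}))")
    case True
    then show ?thesis using ok_empty k pre_last by (intro cyc_good_exists[of "[]"]) auto
  next
    case False
    then obtain a where a: "a \<in> S" "\<not> good (insert (last es) (S - {a}))" "good (insert (hd es) (S - {a}))"
      and typed: "\<forall>e\<in>pre 1. \<exists>s\<in>S. \<not> good (insert e (S - {s}))" using ends by blast
    have es_notin: "e \<in> set es \<Longrightarrow> e \<notin> S" for e using disj by auto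
    \<comment> \<open>Only \<open>a\<close> violates the condition of \<open>cyc_good_exists\<close>
      on unplaced elements, so a suitable prefix containing \<open>a\<close> is enough.\<close>
    have other: "good (S - {s} \<union> pre (card S - 1))" if "s \<in> S - {a}" for s
      using live[OF a(2) a(1), of s] that es_notin[of "last es"] ne k pre_last by simp
    have S_ne: "S \<noteq> {a}" using k r_ge2 by auto
    show ?thesis
    proof (cases "good (insert a (pre 1))")
      case True
      then have "ok {a}" using a k post_hd S_ne by (auto simp: ok_def)
      then have "ok (set (take i [a]))" if "i \<le> length [a]" for i
        using that ok_empty by (cases i) auto
      then show ?thesis using a other by (intro cyc_good_exists[of "[a]"]) auto
    next
      case False
      \<comment> \<open>Now \<open>a\<close> cannot come first. Some \<open>x\<close> outside
        \<open>H\<close> is put before it, which makes both front windows good; the two rear windows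
        exclude at most one \<open>x\<close> each, so three elements of \<open>S - H\<close>
        suffice.\<close>
      then obtain H where H: "H \<in> \<H>" "a \<in> H" "pre 1 \<subseteq> H" by (auto simp: good_def)
      obtain Ha where Ha: "Ha \<in> \<H>" "insert (last es) (S - {a}) \<subseteq> Ha" using a(2) by (rule not_goodE)
      have "a \<notin> Ha" using goodD[OF goodS Ha(1)] Ha by auto
      then have "H \<noteq> Ha" using H by auto
      have lastH: "last es \<in> H" "last es \<notin> S"
        using pre_antimono[of 1 "r - 1"] pre_last r_ge2 H es_notin ne by auto
      \<comment> \<open>Trading \<open>a\<close> for \<open>last es\<close> turns
        \<open>S \<inter> H\<close> into a set of the same size contained in both \<open>H\<close>
        and \<open>Ha\<close>.\<close>
      have small: "card (S \<inter> H) < r - 1"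
      proof (rule ccontr)
        assume "\<not> card (S \<inter> H) < r - 1"
        moreover have "card (insert (last es) (S \<inter> H - {a})) = card (S \<inter> H)"
          using lastH a H finite_S card.remove[of "S \<inter> H" a] by simp
        ultimately have "H = Ha" using H(1) Ha lastH
          by (intro hyp_eqI[of H Ha "insert (last es) (S \<inter> H - {a})"]) auto
        then show False using \<open>H \<noteq> Ha\<close> by simp
      qed
      have "3 \<le> card (S - H)"
      proof (rule ccontr)
        assume "\<not> 3 \<le> card (S - H)"
        moreover have "card (S - H) = r - card (S \<inter> H)" using k finite_S by (simp add: card_Diff_subset_Int)
        ultimately have ge: "r \<le> card (S \<inter> H) + 2" by linarith
        have "\<forall>e. \<exists>s H'. e \<in> pre 1 \<longrightarrow> s \<in> S \<and> H' \<in> \<H> \<and> insert e (S - {s}) \<subseteq> H'"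
          using typed unfolding good_def by blast
        \<comment> \<open>\<open>\<tau> e\<close> is the element of \<open>S\<close> missed by the
          fundamental circuit of \<open>e\<close>, and \<open>K e\<close> a hyperplane through
          \<open>e\<close> and the rest of \<open>S\<close>. If \<open>H\<close> misses at most two
          elements of \<open>S\<close>, then \<open>\<tau>\<close> maps the \<open>r - 1\<close>
          elements of \<open>pre 1\<close> injectively into the smaller set
          \<open>S \<inter> H\<close>.\<close>
        then obtain \<tau> K where \<tau>: "\<And>e. e \<in> pre 1 \<Longrightarrow> \<tau> e \<in> S \<and> K e \<in> \<H> \<and> insert e (S - {\<tau> e}) \<subseteq> K e"
          by metis
        have pre1: "e \<in> pre 1 \<Longrightarrow> e \<in> H \<and> e \<notin> S" for e
          using H(3) es_notin set_drop_subset by fast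
        have KH: "K e \<noteq> H" if "e \<in> pre 1" for e
        proof
          assume "K e = H"
          then have "S - {\<tau> e} \<subseteq> S \<inter> H" using \<tau>[OF that] by auto
          then have "card (S - {\<tau> e}) \<le> card (S \<inter> H)" using finite_S by (intro card_mono) auto
          then show False using small \<tau>[OF that] k by simp
        qed
        have "\<tau> ` pre 1 \<subseteq> S \<inter> H"
        proof safe
          fix e assume e: "e \<in> pre 1"
          show "\<tau> e \<in> S" using \<tau>[OF e] by simp
          show "\<tau> e \<in> H"
          proof (rule ccontr)
            assume "\<tau> e \<notin> H"
            moreover have "card (insert e (S \<inter> H)) = Suc (card (S \<inter> H))" using pre1[OF e] finite_S by simp
            ultimately have "K e = H" using \<tau>[OF e] pre1[OF e] ge H(1)
              by (intro hyp_eqI[of "K e" H "insert e (S \<inter> H)"]) auto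
            then show False using KH[OF e] by simp
          qed
        qed
        moreover have "inj_on \<tau> (pre 1)"
        proof (rule inj_onI, rule ccontr)
          fix e e' assume e: "e \<in> pre 1" "e' \<in> pre 1" "\<tau> e = \<tau> e'" "e \<noteq> e'"
          have "K e = K e'" using \<tau>[OF e(1)] \<tau>[OF e(2)] e(3) by (intro same[of _ _ "\<tau> e"]) auto
          have "card (insert e (insert e' (S \<inter> H - {\<tau> e}))) = Suc (Suc (card (S \<inter> H - {\<tau> e})))"
            using pre1[OF e(1)] pre1[OF e(2)] e(4) finite_S by simp
          moreover have "card (S \<inter> H) \<le> Suc (card (S \<inter> H - {\<tau> e}))"
            by (auto simp: card_Diff_singleton_if)
          ultimately have "K e = H" using \<tau>[OF e(1)] \<tau>[OF e(2)] pre1[OF e(1)] pre1[OF e(2)] ge H(1) \<open>K e = K e'\<close> e(3)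
            by (intro hyp_eqI[of "K e" H "insert e (insert e' (S \<inter> H - {\<tau> e}))"]) auto
          then show False using KH[OF e(1)] by simp
        qed
        ultimately have "card (pre 1) \<le> card (S \<inter> H)" using finite_S by (intro card_inj_on_le) auto
        then show False using small card_pre[of 1] by simp
      qed
      moreover have "card {x \<in> S - H. \<not> good (insert (hd es) (S - {x}))} \<le> Suc 0"
        using finite_S live es_notin[of "hd es"] ne by (subst card_le_Suc0_iff_eq) auto
      moreover have "card {x \<in> S - H. \<not> good (S - {x,a} \<union> post 2)} \<le> Suc 0"
      proof -
        have "3 \<le> r" using \<open>3 \<le> card (S - H)\<close> card_mono[of S "S - H"] finite_S k by auto
        have "x = y" if x: "x \<in> S - H" "\<not> good (S - {x,a} \<union> post 2)"
          and y: "y \<in> S - H" "\<not> good (S - {y,a} \<union> post 2)" for x y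
        proof (rule ccontr)
          assume "x \<noteq> y"
          obtain Hx where Hx: "Hx \<in> \<H>" "S - {x,a} \<union> post 2 \<subseteq> Hx" using x(2) by (rule not_goodE)
          obtain Hy where Hy: "Hy \<in> \<H>" "S - {y,a} \<union> post 2 \<subseteq> Hy" using y(2) by (rule not_goodE)
          have "x \<noteq> a" "y \<noteq> a" using x y H by auto
          then have "card (S - {x,y,a}) = r - 3"
            using x y \<open>x \<noteq> y\<close> a k by (subst card_Diff_subset) auto
          then have "card (S - {x,y,a} \<union> post 2) = r - 1"
            using k \<open>3 \<le> r\<close> by (subst card_Un_post) auto
          then have "Hx = Hy" using Hx Hy by (intro hyp_eqI[of Hx Hy "S - {x,y,a} \<union> post 2"]) auto
          then have "insert (hd es) (S - {a}) \<subseteq> Hx"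
            using Hx Hy \<open>x \<noteq> y\<close> post_hd post_mono[of 1 2] by auto
          then show False using goodD[OF a(3) Hx(1)] by simp
        qed
        then show ?thesis using finite_S by (subst card_le_Suc0_iff_eq) auto
      qed
      moreover have "card ({x \<in> S - H. \<not> good (insert (hd es) (S - {x}))} \<union>
          {x \<in> S - H. \<not> good (S - {x,a} \<union> post 2)}) \<le> 
          card {x \<in> S - H. \<not> good (insert (hd es) (S - {x}))} + card {x \<in> S - H. \<not> good (S - {x,a} \<union> post 2)}"
        by (rule card_Un_le)
      ultimately have "\<not> S - H \<subseteq> {x \<in> S - H. \<not> good (insert (hd es) (S - {x}))} \<union>
          {x \<in> S - H. \<not> good (S - {x,a} \<union> post 2)}"
        using finite_S card_mono[of "{x \<in> S - H. \<not> good (insert (hd es) (S - {x}))} \<union>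
          {x \<in> S - H. \<not> good (S - {x,a} \<union> post 2)}" "S - H"] by fastforce
      then obtain x where x: "x \<in> S" "x \<notin> H" "good (insert (hd es) (S - {x}))" "good (S - {x,a} \<union> post 2)"
        by blast
      have xa: "x \<noteq> a" using x H by auto
      have front1: "good (insert x (pre 1))"
      proof (rule goodI)
        fix H' assume "H' \<in> \<H>" "insert x (pre 1) \<subseteq> H'"
        then have "H' = H" using H card_pre[of 1] by (intro hyp_eqI[of H' H "pre 1"]) auto
        then show False using x \<open>insert x (pre 1) \<subseteq> H'\<close> by auto
      qed
      have front2: "good ({x,a} \<union> pre 2)"
      proof (rule goodI)
        fix H' assume H': "H' \<in> \<H>" "{x,a} \<union> pre 2 \<subseteq> H'"
        have "card ({a} \<union> pre 2) = 1 + (r - 2)" using a by (subst card_Un_pre) auto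
        then have "H' = H" using H H' pre_antimono[of 1 2] by (intro hyp_eqI[of H' H "{a} \<union> pre 2"]) auto
        then show False using x H' by auto
      qed
      have "ok {x}" using front1 x post_hd k by (auto simp: ok_def)
      moreover have "ok {x,a}" using front2 x(4) xa by (auto simp: ok_def numeral_2_eq_2)
      ultimately have "ok (set (take i [x,a]))" if "i \<le> length [x,a]" for i
        using that ok_empty by (cases i; cases "i - 1") auto
      then show ?thesis using a x xa other by (intro cyc_good_exists[of "[x,a]"]) auto
    qed
  qed
qed

end

section \<open>Existence of good cyclic orderings\<close>

context hyperplanes
begin

lemma basis_blockI:
  assumes "good S" "card S = r" "S \<inter> set es = {}" "distinct es" "r \<le> Suc (length es)" "lin_good es"
  shows "block \<H> r es S"
proof
  have "0 < card S" using assms r_ge2 by simp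
  then show "finite S" "0 < card S" by (auto intro: card_ge_0_finite)
qed (use assms in \<open>auto intro: good_mono[OF assms(1)]\<close>)

text \<open>The place of the cut is free. An element of \<open>es\<close> that can replace every
  element of \<open>S\<close> is made the last one; if there is none, the cut goes where the
  replaceability of some fixed \<open>a\<close> changes.\<close>

lemma cyc_good_add_basis:
  assumes S: "good S" "card S = r" "S \<inter> set es = {}"
    and es: "distinct es" "r \<le> Suc (length es)" "\<And>j. lin_good (rotate j es)"
    and sparse: "\<And>H. H \<in> \<H> \<Longrightarrow> 2 \<le> card (S \<union> set es - H)"
  shows "\<exists>xs. distinct xs \<and> set xs = S \<union> set es \<and> cyc_good xs"
proof -
  let ?m = "length es"
  have m: "0 < ?m" using es r_ge2 by linarith
  have blk: "block \<H> r (rotate j es) S" for j using S es by (intro basis_blockI) auto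
  have last: "last (rotate (Suc i) es) = es ! i" if "i < ?m" for i
  proof -
    have "last (rotate (Suc i) es) = rotate (Suc i) es ! (?m - 1)"
      using m by (subst last_conv_nth) (auto simp del: rotate_Suc)
    also have "\<dots> = es ! ((Suc i + (?m - 1)) mod ?m)"
      using m by (intro nth_rotate) auto
    also have "Suc i + (?m - 1) = i + ?m" using m by simp
    finally show ?thesis using that by simp
  qed
  show ?thesis
  proof (cases "\<exists>e\<in>set es. \<forall>s\<in>S. good (insert e (S - {s}))")
    case True
    then obtain i where i: "i < ?m" "\<forall>s\<in>S. good (insert (es ! i) (S - {s}))" by (auto simp: in_set_conv_nth)
    interpret block \<H> r "rotate (Suc i) es" S by (rule blk)
    show ?thesis using cyc_good_basis_block[OF S(2)] last[OF i(1)] i(2) by (simp del: rotate_Suc)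
  next
    case False
    then obtain a where a: "a \<in> S" "\<not> good (insert (es ! 0) (S - {a}))" using m nth_mem by blast
    \<comment> \<open>Without such a change a single hyperplane would contain everything except
      \<open>a\<close>, against \<open>sparse\<close>.\<close>
    have "\<exists>i. Suc i < ?m \<and> \<not> good (insert (es ! i) (S - {a})) \<and> good (insert (es ! Suc i) (S - {a}))"
    proof (rule ccontr)
      assume neg: "\<not> ?thesis"
      have "\<not> good (insert (es ! i) (S - {a}))" if "i < ?m" for i
        using that by (induction i) (use a neg in auto)
      then have "\<not> good (insert e (S - {a}))" if "e \<in> set es" for e using that by (auto simp: in_set_conv_nth)
      moreover have "set es \<noteq> {}" using m by auto
      ultimately obtain H where H: "H \<in> \<H>" "(S - {a}) \<union> set es \<subseteq> H"
        using basis_hyperplane[OF S(2) a(1), of "set es"] by metis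
      have "card (S \<union> set es - H) \<le> card {a}" using H by (intro card_mono) auto
      then show False using sparse[OF H(1)] by simp
    qed
    then obtain i where i: "Suc i < ?m" "\<not> good (insert (es ! i) (S - {a}))" "good (insert (es ! Suc i) (S - {a}))"
      by blast
    interpret block \<H> r "rotate (Suc i) es" S by (rule blk)
    have hd: "hd (rotate (Suc i) es) = es ! Suc i"
      using i(1) m by (simp del: rotate_Suc add: hd_rotate_conv_nth)
    have typed: "\<forall>e\<in>pre 1. \<exists>s\<in>S. \<not> good (insert e (S - {s}))"
    proof
      fix e assume "e \<in> pre 1"
      then have "e \<in> set (rotate (Suc i) es)" by (rule in_set_dropD)
      then show "\<exists>s\<in>S. \<not> good (insert e (S - {s}))" using False by simp
    qed
    have "\<exists>a\<in>S. \<not> good (insert (last (rotate (Suc i) es)) (S - {a})) \<and>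
        good (insert (hd (rotate (Suc i) es)) (S - {a})) \<and> (\<forall>e\<in>pre 1. \<exists>s\<in>S. \<not> good (insert e (S - {s})))"
      using i a(1) last[of i] hd typed by (intro bexI[of _ a]) auto
    then show ?thesis using cyc_good_basis_block[OF S(2)] by (simp del: rotate_Suc)
  qed
qed

text \<open>When \<open>E - S\<close> has \<open>r + 1\<close> elements, all but \<open>z\<close> of them in one hyperplane, it has no good
  cyclic ordering; but placing \<open>z\<close> second makes both windows of the linear ordering good.\<close>

lemma cyc_good_two_basis_plus_one:
  assumes S: "good S" "card S = r" "S \<inter> insert z D = {}"
    and D: "card D = r" "D \<subseteq> H" "H \<in> \<H>" "z \<notin> H" "card (S \<inter> H) + 2 \<le> r"
  shows "\<exists>xs. distinct xs \<and> set xs = S \<union> insert z D \<and> cyc_good xs"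
proof -
  have fD: "finite D" and fS: "finite S" using D(1) S(2) r_ge2 by (auto intro: card_ge_0_finite)
  have zD: "z \<notin> D" using D by auto
  \<comment> \<open>\<open>f\<close> and \<open>l\<close> become the first and last element of
    \<open>es\<close>. If no element of \<open>D\<close> could replace \<open>a\<close>, the
    hyperplane through \<open>D\<close> and \<open>S - {a}\<close> would be \<open>H\<close>, which
    contains too little of \<open>S\<close>.\<close>
  have "\<exists>f\<in>D. \<exists>l\<in>D. f \<noteq> l \<and> ((\<forall>s\<in>S. good (insert l (S - {s}))) \<or>
      (\<exists>a\<in>S. \<not> good (insert l (S - {a})) \<and> good (insert f (S - {a})) \<and>
        (\<forall>e\<in>D. \<exists>s\<in>S. \<not> good (insert e (S - {s})))))"
  proof (cases "\<exists>e\<in>D. \<forall>s\<in>S. good (insert e (S - {s}))")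
    case True
    then obtain l where l: "l \<in> D" "\<forall>s\<in>S. good (insert l (S - {s}))" by blast
    have "card (D - {l}) \<noteq> 0" using D r_ge2 l by simp
    then obtain f where "f \<in> D" "f \<noteq> l" by (metis card.empty Diff_iff ex_in_conv singletonI)
    then show ?thesis using l by blast
  next
    case False
    have "D \<noteq> {}" using D r_ge2 by auto
    then obtain l a where l: "l \<in> D" "a \<in> S" "\<not> good (insert l (S - {a}))" using False by blast
    have "\<exists>f\<in>D. good (insert f (S - {a}))"
    proof (rule ccontr)
      assume "\<not> ?thesis"
      then obtain H' where H': "H' \<in> \<H>" "(S - {a}) \<union> D \<subseteq> H'"
        using basis_hyperplane[OF S(2) l(2) \<open>D \<noteq> {}\<close>] by blast
      then have "H' = H" using D by (intro hyp_eqI[of H' H D]) auto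
      then have "card (S - {a}) \<le> card (S \<inter> H)" using H' fS by (intro card_mono) auto
      then show False using D(5) l(2) S(2) by simp
    qed
    then obtain f where "f \<in> D" "good (insert f (S - {a}))" by blast
    moreover from this l have "f \<noteq> l" by auto
    ultimately show ?thesis using l False by blast
  qed
  then obtain f l where fl: "f \<in> D" "l \<in> D" "f \<noteq> l" and ends: "(\<forall>s\<in>S. good (insert l (S - {s}))) \<or>
      (\<exists>a\<in>S. \<not> good (insert l (S - {a})) \<and> good (insert f (S - {a})) \<and>
        (\<forall>e\<in>D. \<exists>s\<in>S. \<not> good (insert e (S - {s}))))" by blast
  obtain ds where ds: "set ds = D - {f,l}" "distinct ds" using fD finite_distinct_list[of "D - {f,l}"] by auto
  define es where "es = f # z # ds @ [l]"
  have es: "distinct es" "set es = insert z D" using ds fl zD by (auto simp: es_def)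
  have len: "length es = r + 1" using es fD D(1) zD distinct_card[of es] by simp
  have "lin_good es"
    unfolding lin_good_def
  proof (intro allI impI goodI)
    fix i H' assume i: "i + r \<le> length es" and H': "H' \<in> \<H>" "set (take r (drop i es)) \<subseteq> H'"
    let ?V = "set (take r (drop i es))"
    have V: "card ?V = r" using i es by (simp add: distinct_card)
    have "i = 0 \<or> i = 1" using i len by linarith
    \<comment> \<open>Both windows contain the second entry \<open>z\<close>; their other
      \<open>r - 1\<close> elements lie in \<open>D\<close> and leave \<open>H\<close> as the only
      candidate, but \<open>z\<close> is outside \<open>H\<close>.\<close>
    then have "z \<in> ?V" using r_ge2 by (cases r; cases "r - 1") (auto simp: es_def)
    moreover have "?V \<subseteq> insert z D" using set_take_subset set_drop_subset es(2) by fast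
    ultimately have "H' = H" using H' D V by (intro hyp_eqI[of H' H "?V - {z}"]) auto
    then show False using \<open>z \<in> ?V\<close> H' D by auto
  qed
  then interpret block \<H> r es S using S es len by (intro basis_blockI) auto
  have "pre 1 \<subseteq> D"
  proof -
    have "length es - (r - 1) = 2" using len r_ge2 by simp
    then show ?thesis using ds fl by (simp add: es_def)
  qed
  moreover have "last es = l" "hd es = f" by (auto simp: es_def)
  ultimately have "(\<forall>s\<in>S. good (insert (last es) (S - {s}))) \<or>
      (\<exists>a\<in>S. \<not> good (insert (last es) (S - {a})) \<and> good (insert (hd es) (S - {a})) \<and>
        (\<forall>e\<in>pre 1. \<exists>s\<in>S. \<not> good (insert e (S - {s}))))"
    using ends by blast
  then show ?thesis using cyc_good_basis_block[OF S(2)] es(2) by simp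
qed

section \<open>Removing a basis while keeping the density condition\<close>

text \<open>Some \<open>r - 1\<close> elements lie in at most one hyperplane; any further element
  outside it completes them.\<close>

lemma basis_exists:
  assumes "r \<le> card E" "\<And>H. H \<in> \<H> \<Longrightarrow> \<not> E \<subseteq> H"
  obtains S where "S \<subseteq> E" "card S = r" "good S"
proof -
  obtain A where A: "A \<subseteq> E" "card A = r - 1" "finite A"
    using assms(1) by (metis diff_le_self le_trans obtain_subset_with_card_n)
  have "\<not> E \<subseteq> A"
  proof
    assume "E \<subseteq> A"
    then have "card E \<le> card A" using A by (intro card_mono) auto
    then show False using A assms r_ge2 by linarith
  qed
  have "\<exists>x. x \<in> E \<and> x \<notin> A \<and> (\<forall>H\<in>\<H>. A \<subseteq> H \<longrightarrow> x \<notin> H)"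
  proof (cases "\<exists>H\<in>\<H>. A \<subseteq> H")
    case True
    then obtain H where H: "H \<in> \<H>" "A \<subseteq> H" by blast
    then have "H' = H" if "H' \<in> \<H>" "A \<subseteq> H'" for H' using that A by (intro hyp_eqI[of H' H A]) auto
    then show ?thesis using assms(2)[OF H(1)] H by blast
  qed (use \<open>\<not> E \<subseteq> A\<close> in blast)
  then obtain x where x: "x \<in> E" "x \<notin> A" "\<forall>H\<in>\<H>. A \<subseteq> H \<longrightarrow> x \<notin> H" by blast
  then show ?thesis using A r_ge2 by (intro that[of "insert x A"]) (auto simp: good_def)
qed

text \<open>Inclusion-exclusion, as distinct hyperplanes share at most \<open>r - 2\<close>
  elements.\<close>

lemma card_Int_hyperplanes:
  assumes "finite X" "H \<in> \<H>" "H' \<in> \<H>" "H \<noteq> H'"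
  shows "card (X \<inter> H) + card (X \<inter> H') + 2 \<le> card X + r"
proof -
  have "\<not> r \<le> Suc (card (X \<inter> H \<inter> H'))" using assms hyp_eqI[of H H' "X \<inter> H \<inter> H'"] by blast
  moreover have "card (X \<inter> H) + card (X \<inter> H') = card (X \<inter> (H \<union> H')) + card (X \<inter> H \<inter> H')"
    using assms by (subst card_Un_Int) (auto simp: Int_Un_distrib Int_ac)
  moreover have "card (X \<inter> (H \<union> H')) \<le> card X" using assms by (intro card_mono) auto
  ultimately show ?thesis by linarith
qed

text \<open>\<open>S\<close> minimizes the largest trace \<open>N\<close> of a hyperplane on
  \<open>E - S\<close>. If density fails there, an exchange that lowers the trace of an extremal
  \<open>H\<close> must leave another hyperplane with trace at least \<open>N\<close>. Two traces
  that large leave only the exceptional case or rank 2, and rank 2 is refuted.\<close>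

lemma balanced_basis_exists:
  assumes E: "finite E" "2 * r \<le> card E" and dense: "\<And>H. H \<in> \<H> \<Longrightarrow> card E \<le> r * card (E - H)"
  obtains S where "S \<subseteq> E" "card S = r" "good S" "\<And>H. H \<in> \<H> \<Longrightarrow> card (E - S) \<le> r * card (E - S - H)"
  | S H where "S \<subseteq> E" "card S = r" "good S" "card (E - S) = r + 1"
      "H \<in> \<H>" "card ((E - S) \<inter> H) = r" "card (S \<inter> H) + 2 \<le> r"
proof -
  define P where "P N \<longleftrightarrow> (\<exists>S\<subseteq>E. card S = r \<and> good S \<and> (\<forall>H\<in>\<H>. card ((E - S) \<inter> H) \<le> N))" for N
  have "\<not> E \<subseteq> H" if "H \<in> \<H>" for H
  proof
    assume "E \<subseteq> H"
    then have "E - H = {}" by auto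
    then show False using dense[OF that] E r_ge2 by (metis card.empty mult_0_right le_zero_eq mult_is_0 not_numeral_le_zero)
  qed
  then obtain S0 where "S0 \<subseteq> E" "card S0 = r" "good S0" using basis_exists E by (metis le_add2 le_trans mult_2)
  moreover have "card ((E - S0) \<inter> H) \<le> card E" for H using E by (intro card_mono) auto
  ultimately have "P (card E)" unfolding P_def by blast
  define N where "N = (LEAST N. P N)"
  have "P N" unfolding N_def using \<open>P (card E)\<close> by (rule LeastI)
  then obtain S where S: "S \<subseteq> E" "card S = r" "good S" and bound: "\<And>H. H \<in> \<H> \<Longrightarrow> card ((E - S) \<inter> H) \<le> N"
    unfolding P_def by blast
  have fS: "finite S" using S E finite_subset by auto
  show thesis
  proof (cases "\<forall>H\<in>\<H>. card (E - S) \<le> r * card (E - S - H)")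
    case True
    then show ?thesis using that(1)[OF S] by blast
  next
    case False
    then obtain H0 where H0: "H0 \<in> \<H>" "r * card (E - S - H0) < card (E - S)" by auto
    let ?n = "card (E - S)"
    have n: "?n = card E - r" using S fS by (simp add: card_Diff_subset)
    have split: "card (X - H) + card (X \<inter> H) = card X" if "finite X" for X H :: "'a set"
      using that by (metis add.commute card_Int_Diff)
    have "E - S - H0 \<noteq> E - S" using H0 r_ge2 by (metis mult_le_mono1 nat_mult_1 not_le one_le_numeral order_trans)
    then have "card ((E - S) \<inter> H0) \<noteq> 0" using E by auto
    then have "N \<noteq> 0" using bound[OF H0(1)] by auto
    have large: "\<exists>H'\<in>\<H>. N \<le> card ((E - S') \<inter> H')" if "S' \<subseteq> E" "card S' = r" "good S'" for S'
    proof (rule ccontr)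
      assume "\<not> ?thesis"
      then have "P (N - 1)" using that unfolding P_def by (intro exI[of _ S']) force
      then show False using not_less_Least[of "N - 1" P] \<open>N \<noteq> 0\<close> by (simp add: N_def)
    qed
    obtain H where H: "H \<in> \<H>" "card ((E - S) \<inter> H) = N" using large[OF S] bound by force
    define u where "u = card (E - S - H)"
    have u: "u + N = ?n" using split[of "E - S" H] E H by (simp add: u_def)
    have "card (E - S - H0) + card ((E - S) \<inter> H0) = ?n" using split[of "E - S" H0] E by simp
    then have "u \<le> card (E - S - H0)" using bound[OF H0(1)] u by linarith
    then have ru: "r * u < ?n" using H0(2) by (meson le_less_trans mult_le_mono2)
    \<comment> \<open>The density of \<open>E\<close> at \<open>H\<close>, compared with
      \<open>r * u < ?n\<close>, leaves at least two elements of \<open>S\<close> outside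
      \<open>H\<close>.\<close>
    have SH: "card (S \<inter> H) + 2 \<le> r"
    proof -
      have "card (E - H) = u + card (S - H)"
      proof -
        have "E - H = (E - S - H) \<union> (S - H)" using S by auto
        then show ?thesis using E fS by (simp add: u_def card_Un_disjoint Diff_Int_distrib2 Int_Diff disjoint_iff)
      qed
      then have "?n + r \<le> r * u + r * card (S - H)" using dense[OF H(1)] n E by (simp add: distrib_left)
      then have "r * 1 < r * card (S - H)" using ru by linarith
      then have "1 < card (S - H)" by (simp only: mult_less_cancel1)
      then show ?thesis using split[OF fS, of H] S by linarith
    qed
    \<comment> \<open>The exchange takes \<open>y\<close> away from the trace of \<open>H\<close>
      and adds nothing to it, so by minimality the bound \<open>N\<close> is reached by another
      hyperplane.\<close>
    have swap: "\<exists>H'\<in>\<H>. H' \<noteq> H \<and> N \<le> card ((E - insert y (S - {x})) \<inter> H')"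
      and swap_card: "card (E - insert y (S - {x})) = ?n" "card ((E - insert y (S - {x})) \<inter> H) + 1 = N"
      if x: "x \<in> S" "x \<notin> H" and y: "y \<in> E" "y \<notin> S" "y \<in> H" and g: "good (insert y (S - {x}))" for x y
    proof -
      have c: "card (insert y (S - {x})) = r" using x y S fS r_ge2 by simp
      then show "card (E - insert y (S - {x})) = ?n"
        using n S y fS by (subst card_Diff_subset) auto
      have "(E - insert y (S - {x})) \<inter> H = (E - S) \<inter> H - {y}" using x by auto
      moreover have "card ((E - S) \<inter> H - {y}) + 1 = card ((E - S) \<inter> H)"
        using E y card.remove[of "(E - S) \<inter> H" y] by simp
      ultimately show eq: "card ((E - insert y (S - {x})) \<inter> H) + 1 = N" using H(2) by simp
      obtain H' where "H' \<in> \<H>" "N \<le> card ((E - insert y (S - {x})) \<inter> H')"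
        using large[of "insert y (S - {x})"] c g y S by auto
      then show "\<exists>H'\<in>\<H>. H' \<noteq> H \<and> N \<le> card ((E - insert y (S - {x})) \<inter> H')"
        using eq by (intro bexI[of _ H']) auto
    qed
    have "(E - S) \<inter> H \<noteq> {}" using H \<open>N \<noteq> 0\<close> by auto
    then obtain y where y: "y \<in> E" "y \<notin> S" "y \<in> H" by auto
    have "2 \<le> card (S - H)" using split[OF fS, of H] SH S by linarith
    then have "\<not> (\<forall>x\<in>S-H. \<forall>y\<in>S-H. x = y)" using fS card_le_Suc0_iff_eq[of "S - H"] by auto
    then obtain x x' where x: "x \<in> S" "x \<notin> H" "x' \<in> S" "x' \<notin> H" "x \<noteq> x'" by blast
    obtain w where w: "w \<in> S" "w \<notin> H" "good (insert y (S - {w}))"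
      using basis_exchange_unique[OF S(3,2) x(1,3,5) y(2)] x by blast
    obtain H' where H': "H' \<in> \<H>" "H' \<noteq> H" "N \<le> card ((E - insert y (S - {w})) \<inter> H')"
      using swap[OF w(1,2) y w(3)] by blast
    have "2 * N + 1 \<le> ?n + r"
      using card_Int_hyperplanes[of "E - insert y (S - {w})" H H'] E H H' swap_card[OF w(1,2) y w(3)] by simp
    \<comment> \<open>Together with \<open>r * u < ?n\<close> this says
      \<open>(r - 2) * (u - 1) \<le> 0\<close> over the integers: either \<open>r = 2\<close> or
      \<open>u \<le> 1\<close>.\<close>
    then have nu: "?n + 1 \<le> r + 2 * u" using u by linarith
    have rn: "r \<le> ?n" using n E by linarith
    show ?thesis
    proof (cases "r = 2")
      case False
      have "u < 2"
      proof (rule ccontr)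
        assume "\<not> u < 2"
        then obtain v where v: "u = v + 2" by (metis add.commute le_Suc_ex not_less)
        obtain q where q: "r = q + 2" "q \<noteq> 0" using False r_ge2 by (metis add.commute add_0_right le_Suc_ex)
        show False using ru nu unfolding v q by (simp add: algebra_simps) (use q in linarith)
      qed
      moreover have "u \<noteq> 0" using nu rn by linarith
      ultimately have "u = 1" by linarith
      then show ?thesis using that(2)[OF S _ H(1) _ SH] H u ru nu by simp
    next
      case True
      then have nN: "?n = 2 * u + 1" "N = u + 1" "u \<noteq> 0" using ru nu u rn unfolding True by linarith+
      then obtain z where z: "z \<in> E" "z \<notin> S" "z \<notin> H" by (metis Diff_iff card.empty ex_in_conv u_def)
      \<comment> \<open>In rank 2 distinct hyperplanes are disjoint, so counting forces
        \<open>K\<close> to contain all of the new complement outside \<open>H\<close>, in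
        particular \<open>w\<close> and \<open>z\<close>. Used for both elements of
        \<open>S\<close>, this puts \<open>S\<close> into the one hyperplane through
        \<open>z\<close>.\<close>
      have both: "\<exists>K\<in>\<H>. w \<in> K \<and> z \<in> K" if w: "w \<in> S" "w \<notin> H" and w': "w' \<in> S" "w' \<notin> H" "w \<noteq> w'" for w w'
      proof -
        have good: "good (insert y (S - {w}))"
        proof (rule goodI)
          fix K assume K: "K \<in> \<H>" "insert y (S - {w}) \<subseteq> K"
          then have "K = H" using H y True by (intro hyp_eqI[of K H "{y}"]) auto
          then show False using K w' w by auto
        qed
        obtain K where K: "K \<in> \<H>" "K \<noteq> H" "N \<le> card ((E - insert y (S - {w})) \<inter> K)"
          using swap[OF w y good] by blast
        let ?X = "E - insert y (S - {w})"
        have "t \<notin> H" if "t \<in> K" for t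
          using hyp_eqI[of K H "{t}"] K H True that by auto
        then have "?X \<inter> K \<subseteq> ?X - H" by auto
        moreover have "card (?X - H) = u + 1" using split[of ?X H] swap_card[OF w y good] E nN by simp
        ultimately have "?X \<inter> K = ?X - H" using K nN E by (intro card_seteq) auto
        then show ?thesis using K(1) z w y S by blast
      qed
      obtain K where K: "K \<in> \<H>" "x \<in> K" "z \<in> K" using both[OF x(1,2,3,4,5)] by blast
      obtain K' where K': "K' \<in> \<H>" "x' \<in> K'" "z \<in> K'" using both[OF x(3,4,1,2) x(5)[symmetric]] by blast
      have "K = K'" using K K' True by (intro hyp_eqI[of K K' "{z}"]) auto
      moreover have "{x, x'} = S" using x S True fS by (intro card_seteq) auto
      ultimately show ?thesis using goodD[OF S(3) K(1)] K K' by auto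
    qed
  qed
qed

section \<open>Ground sets with more than \<open>r\<close> and fewer than \<open>2 * r - 1\<close>
  elements\<close>

text \<open>For \<open>r < card E < 2 * r - 1\<close> it is easier to work with complements: \<open>card E - r\<close> consecutive
  elements must have a good complement, and at each step at most one element cannot be appended.\<close>

lemma complement_extend_unique:
  assumes E: "finite E" and Q: "Q \<subseteq> E" "card Q + r + 1 \<le> card E" "good (E - Q)"
    and y: "y \<in> E - Q" "y' \<in> E - Q" "y \<noteq> y'"
  shows "good (E - insert y Q) \<or> good (E - insert y' Q)"
proof (rule ccontr)
  assume bad: "\<not> ?thesis"
  have "finite Q" using E Q finite_subset by auto
  obtain H where H: "H \<in> \<H>" "E - insert y Q \<subseteq> H" using bad not_goodE by metis
  obtain H' where H': "H' \<in> \<H>" "E - insert y' Q \<subseteq> H'" using bad not_goodE by metis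
  have "card (E - insert y (insert y' Q)) = card E - (card Q + 2)"
    using E Q y \<open>finite Q\<close> by (subst card_Diff_subset) auto
  then have "r \<le> Suc (card (E - insert y (insert y' Q)))" using Q by linarith
  then have "H = H'" using H H' by (intro hyp_eqI[of H H' "E - insert y (insert y' Q)"]) auto
  then have "E - Q \<subseteq> H" using H H' y by auto
  then show False using goodD[OF Q(3) H(1)] by simp
qed

definition co_good :: "'a set \<Rightarrow> 'a list \<Rightarrow> bool" where
  "co_good E ys \<longleftrightarrow> distinct ys \<and> set ys \<subseteq> E \<and>
    (\<forall>i. i + (card E - r) \<le> length ys \<longrightarrow> good (E - set (take (card E - r) (drop i ys))))"

lemma co_good_extend:
  assumes E: "finite E" "r < card E"
  shows "co_good E ys \<Longrightarrow> card E - r \<le> length ys \<Longrightarrow> length ys \<le> r - 1 \<Longrightarrow>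
    \<exists>ws. co_good E (ys @ ws) \<and> length (ys @ ws) = r - 1"
proof (induction "r - 1 - length ys" arbitrary: ys)
  case 0
  then show ?case by (intro exI[of _ "[]"]) auto
next
  case (Suc k)
  let ?s = "card E - r"
  have ys: "distinct ys" "set ys \<subseteq> E" using Suc.prems by (auto simp: co_good_def)
  have win: "good (E - set (take ?s (drop i ys)))" if "i + ?s \<le> length ys" for i
    using Suc.prems(1) that by (simp add: co_good_def)
  define Q where "Q = set (drop (length ys - (?s - 1)) ys)"
  have Q: "Q \<subseteq> set ys" by (simp add: Q_def set_drop_subset)
  have "card Q = ?s - 1" using ys Suc.prems by (simp add: Q_def distinct_card)
  then have cQ: "card Q + r + 1 \<le> card E" using E by linarith
  have "good (E - Q)"
  proof (rule good_mono)
    show "good (E - set (take ?s (drop (length ys - ?s) ys)))"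
      using Suc.prems by (intro win) simp
    have "Q \<subseteq> set (drop (length ys - ?s) ys)" unfolding Q_def by (intro set_drop_subset_set_drop) simp
    then show "E - set (take ?s (drop (length ys - ?s) ys)) \<subseteq> E - Q" by auto
  qed
  moreover have "2 \<le> card (E - set ys)"
    using E ys Suc.prems Suc.hyps(2) by (simp add: card_Diff_subset distinct_card)
  then have "\<not> (\<forall>x\<in>E - set ys. \<forall>y\<in>E - set ys. x = y)"
    using E card_le_Suc0_iff_eq[of "E - set ys"] by auto
  then obtain y y' where "y \<in> E - set ys" "y' \<in> E - set ys" "y \<noteq> y'" by blast
  ultimately obtain y where y: "y \<in> E" "y \<notin> set ys" "good (E - insert y Q)"
    using complement_extend_unique[OF E(1) _ cQ, of y y'] Q ys by blast
  have "co_good E (ys @ [y])"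
    unfolding co_good_def
  proof (intro conjI allI impI)
    fix i assume i: "i + ?s \<le> length (ys @ [y])"
    show "good (E - set (take ?s (drop i (ys @ [y]))))"
    proof (cases "i + ?s \<le> length ys")
      case True
      then show ?thesis using win by simp
    next
      case False
      then have "i = length ys - (?s - 1)" "length ys - i = ?s - 1" using i E Suc.prems by auto
      then have "set (take ?s (drop i (ys @ [y]))) = insert y Q" using E by (simp add: Q_def)
      then show ?thesis using y by simp
    qed
  qed (use y ys in auto)
  moreover have "k = r - 1 - length (ys @ [y])" "length (ys @ [y]) \<le> r - 1" using Suc.hyps(2) by auto
  ultimately obtain ws where "co_good E ((ys @ [y]) @ ws)" "length ((ys @ [y]) @ ws) = r - 1"
    using Suc.hyps(1)[of "ys @ [y]"] Suc.prems by auto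
  then show ?case by (intro exI[of _ "y # ws"]) auto
qed

text \<open>\<open>es\<close> is too short to contain a window, and a window around the whole block
  is the complement of \<open>card E - r\<close> consecutive entries of \<open>es\<close>.
  \<open>live\<close> is the condition of \<open>cyc_good_exists\<close> rewritten by
  complements.\<close>

lemma cyc_good_co_good:
  assumes E: "finite E" "r < card E" "card E + 2 \<le> 2 * r"
    and es: "co_good E es" "length es = r - 1"
    and live: "\<And>s. s \<in> E - set es \<Longrightarrow> good (E - insert s (set (take (card E - r - 1) es)))"
  shows "\<exists>xs. distinct xs \<and> set xs = E \<and> cyc_good xs"
proof -
  let ?s = "card E - r" and ?S = "E - set es"
  have es': "distinct es" "set es \<subseteq> E" using es by (auto simp: co_good_def)
  have card_S: "card ?S = ?s + 1"
    using E es' es(2) r_ge2 by (simp add: card_Diff_subset distinct_card)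
  interpret block \<H> r es ?S
  proof
    show "lin_good es" using es(2) r_ge2 by (auto simp: lin_good_def)
    fix j assume j: "j \<le> r - card ?S"
    have "good (E - set (take ?s (drop j es)))"
      using es j card_S E by (simp add: co_good_def)
    moreover have "set es = set (take j es) \<union> set (take ?s (drop j es)) \<union> set (drop (j + ?s) es)"
      by (metis append_take_drop_id add.commute drop_drop set_append Un_assoc)
    moreover have "length es - (r - card ?S - j) = j + ?s" using es(2) j card_S E by simp
    ultimately show "good (?S \<union> set (take j es) \<union> set (drop (length es - (r - card ?S - j)) es))"
      by (auto intro: good_mono)
  qed (use E es' es(2) card_S in auto)
  have "good (?S - {s} \<union> pre (card ?S - 1))" if s: "s \<in> ?S" for s
  proof (rule good_mono[OF live[OF s]])
    have "length es - (r - (card ?S - 1)) = ?s - 1" using es(2) card_S E by simp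
    moreover have "set es = set (take (?s - 1) es) \<union> set (drop (?s - 1) es)"
      by (metis append_take_drop_id set_append)
    ultimately show "E - insert s (set (take (card E - r - 1) es)) \<subseteq> ?S - {s} \<union> pre (card ?S - 1)"
      by auto
  qed
  then have "\<exists>xs. distinct xs \<and> set xs = ?S \<union> set es \<and> cyc_good xs"
    using ok_empty by (intro cyc_good_exists[of "[]"]) auto
  then show ?thesis using es' by (simp add: Un_absorb2 Un_Diff_cancel2)
qed

text \<open>\<open>es\<close> starts with \<open>P\<close>, a basis complement minus one element.
  Then at most one element \<open>s0\<close> violates the condition on the block, and if it exists
  it is moved into \<open>es\<close>.\<close>

lemma cyc_good_small:
  assumes E: "finite E" "r < card E" "card E + 2 \<le> 2 * r"
    and sparse: "\<And>H. H \<in> \<H> \<Longrightarrow> 2 \<le> card (E - H)"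
  shows "\<exists>xs. distinct xs \<and> set xs = E \<and> cyc_good xs"
proof -
  let ?s = "card E - r"
  have "\<not> E \<subseteq> H" if "H \<in> \<H>" for H using sparse[OF that] by (auto simp: Diff_eq_empty_iff[THEN iffD2])
  then obtain B where B: "B \<subseteq> E" "card B = r" "good B" using basis_exists[of E] E by (metis less_imp_le)
  have "finite B" using B E finite_subset by auto
  define Y where "Y = E - B"
  have Y: "card Y = ?s" "Y \<subseteq> E" "E - Y = B" "finite Y"
    using B E \<open>finite B\<close> by (auto simp: Y_def card_Diff_subset)
  have "Y \<noteq> {}" using Y(1) E by auto
  then obtain e where e: "e \<in> Y" by auto
  define P where "P = Y - {e}"
  have P: "card P = ?s - 1" "P \<subseteq> E" "finite P" "Y = insert e P" "e \<notin> P" using Y e by (auto simp: P_def)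
  have EP: "good (E - P)" using good_mono[OF B(3)] Y P by blast
  show ?thesis
  proof (cases "\<forall>s\<in>E - P. good (E - insert s P)")
    case True
    obtain ps where ps: "set ps = P" "distinct ps" using finite_distinct_list P(3) by blast
    have len: "length ps = ?s - 1" using ps P distinct_card by metis
    have "co_good E (ps @ [e])"
      unfolding co_good_def
    proof (intro conjI allI impI)
      have set_eq: "set (ps @ [e]) = Y" and l: "length (ps @ [e]) = ?s" using ps P E len by auto
      then show "set (ps @ [e]) \<subseteq> E" using Y(2) by simp
      show "distinct (ps @ [e])" using ps P by simp
      fix i assume "i + ?s \<le> length (ps @ [e])"
      then have "i = 0" using l by simp
      then have "take ?s (drop i (ps @ [e])) = ps @ [e]" using l by simp
      then show "good (E - set (take ?s (drop i (ps @ [e]))))" using Y(3) B(3) set_eq by simp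
    qed
    moreover have "?s \<le> length (ps @ [e])" "length (ps @ [e]) \<le> r - 1" using len E by auto
    ultimately obtain ws where ws: "co_good E ((ps @ [e]) @ ws)" "length ((ps @ [e]) @ ws) = r - 1"
      using co_good_extend[OF E(1,2), of "ps @ [e]"] by blast
    show ?thesis
      using True ps len by (intro cyc_good_co_good[OF E ws]) auto
  next
    case False
    then obtain s0 where s0: "s0 \<in> E - P" "\<not> good (E - insert s0 P)" by blast
    obtain H where H: "H \<in> \<H>" "E - insert s0 P \<subseteq> H" using s0(2) by (rule not_goodE)
    have "s0 \<noteq> e" using s0 B Y P by auto
    \<comment> \<open>Otherwise \<open>H\<close> would miss only \<open>s0\<close>. An
      \<open>f\<close> in \<open>P - H\<close> goes first in \<open>es\<close>: the second window
      drops \<open>f\<close>, so its complement contains \<open>f\<close> and cannot lie in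
      \<open>H\<close>.\<close>
    have "P - H \<noteq> {}"
    proof
      assume "P - H = {}"
      then have "card (E - H) \<le> card {s0}" using H by (intro card_mono) auto
      then show False using sparse[OF H(1)] by simp
    qed
    then obtain f where f: "f \<in> P" "f \<notin> H" by auto
    obtain ps where ps: "set ps = P - {f}" "distinct ps" using finite_distinct_list[of "P - {f}"] P(3) by auto
    have "length (f # ps) = ?s - 1" using ps P f distinct_card[of "f # ps"] by (auto simp: insert_absorb)
    have fW: "good (E - insert s0 (insert e (set ps)))"
    proof (rule goodI)
      fix H' assume H': "H' \<in> \<H>" "E - insert s0 (insert e (set ps)) \<subseteq> H'"
      have "card (E - insert s0 Y) = card E - (?s + 1)"
        using Y P s0 \<open>s0 \<noteq> e\<close> by (subst card_Diff_subset) auto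
      then have "r \<le> Suc (card (E - insert s0 Y))" using E by linarith
      then have "H = H'" using H H' P ps by (intro hyp_eqI[of H H' "E - insert s0 Y"]) auto
      moreover have "f \<in> H'" using H' f ps P s0 by auto
      ultimately show False using f by simp
    qed
    let ?ys = "f # ps @ [e, s0]"
    have set_ys: "distinct ?ys" "set ?ys \<subseteq> E" "length ?ys = ?s + 1"
      using ps f P s0 \<open>s0 \<noteq> e\<close> Y e \<open>length (f # ps) = ?s - 1\<close> by auto
    have "co_good E ?ys"
      unfolding co_good_def
    proof (intro conjI allI impI)
      fix i assume "i + ?s \<le> length ?ys"
      then consider "i = 0" | "i = 1" using set_ys(3) by linarith
      then show "good (E - set (take ?s (drop i ?ys)))"
      proof cases
        case 1
        have "take ?s ?ys = f # ps @ [e]" using set_ys(3) by (cases ?s) auto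
        then have "set (take ?s ?ys) = Y" using ps f P by auto
        then show ?thesis using 1 Y B by simp
      next
        case 2
        have "take ?s (drop 1 ?ys) = ps @ [e, s0]" using set_ys(3) by auto
        then show ?thesis using 2 fW by (simp add: insert_commute)
      qed
    qed (use set_ys in auto)
    moreover have "length ?ys \<le> r - 1" "?s \<le> length ?ys" using set_ys(3) E by linarith+
    ultimately obtain ws where ws: "co_good E (?ys @ ws)" "length (?ys @ ws) = r - 1"
      using co_good_extend[OF E(1,2), of ?ys] by blast
    have "card P + r + 1 \<le> card E" using P(1) E by linarith
    then have "good (E - insert s P)" if "s \<in> E - P" "s \<noteq> s0" for s
      using complement_extend_unique[OF E(1) P(2) _ EP that(1) s0(1) that(2)] s0(2) by blast
    moreover have "take (?s - 1) (?ys @ ws) = f # ps" using \<open>length (f # ps) = ?s - 1\<close> by (cases "?s - 1") auto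
    moreover have "set (f # ps) = P" using ps f by auto
    ultimately show ?thesis using f by (intro cyc_good_co_good[OF E ws]) auto
  qed
qed

section \<open>Induction on the size of the ground set\<close>

theorem cyc_good_ordering_exists:
  assumes "finite E" "r \<le> card E" "\<And>H. H \<in> \<H> \<Longrightarrow> card E \<le> r * card (E - H)"
  shows "\<exists>xs. distinct xs \<and> set xs = E \<and> cyc_good xs"
  using assms
proof (induction "card E" arbitrary: E rule: less_induct)
  case less
  note E = less.prems
  have sub: "\<not> E \<subseteq> H" if "H \<in> \<H>" for H
  proof
    assume "E \<subseteq> H"
    then have "card (E - H) = 0" by (metis Diff_eq_empty_iff card.empty)
    then have "card E \<le> r * 0" using E(3)[OF that] by (simp only:)
    then show False using E(2) r_ge2 by simp
  qed
  have two: "2 \<le> card (E - H)" if "r < card E" "H \<in> \<H>" for H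
  proof -
    have "r * 1 < r * card (E - H)" using E(3)[OF that(2)] that(1) by linarith
    then have "1 < card (E - H)" by (simp only: mult_less_cancel1)
    then show ?thesis by simp
  qed
  consider "card E = r" | "r < card E" "card E + 2 \<le> 2 * r" | "card E = 2 * r - 1" "r < card E" | "2 * r \<le> card E"
    using E r_ge2 by linarith
  then show ?case
  proof cases
    case 1
    obtain xs where xs: "set xs = E" "distinct xs" using finite_distinct_list E by blast
    have len: "length xs = r" using xs 1 distinct_card by metis
    have "set (take r (drop i (xs @ xs))) = E" if "i < length xs" for i
    proof -
      have "take r (drop i (xs @ xs)) = drop i xs @ take i xs" using that len by simp
      then show ?thesis using xs by (metis append_take_drop_id set_append Un_commute)
    qed
    then show ?thesis using xs sub by (intro exI[of _ xs]) (auto simp: cyc_good_def good_def)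
  next
    case 2
    then show ?thesis using cyc_good_small E two by blast
  next
    case 3
    obtain S where S: "S \<subseteq> E" "card S = r" "good S" using basis_exists E sub by blast
    obtain es where es: "set es = E - S" "distinct es" using finite_distinct_list[of "E - S"] E(1) by auto
    have "finite S" using S E finite_subset by auto
    then have len: "length es = r - 1"
      using es S 3 distinct_card[of es] by (simp add: card_Diff_subset)
    \<comment> \<open>A list of \<open>r - 1\<close> elements has no window of length
      \<open>r\<close>, so every rotation qualifies.\<close>
    have "lin_good (rotate j es)" for j using len r_ge2 by (auto simp: lin_good_def)
    moreover have "S \<union> set es = E" using es S by auto
    ultimately show ?thesis using cyc_good_add_basis[of S es] S es len two[OF 3(2)] by auto
  next
    case 4
    show ?thesis
    proof (rule balanced_basis_exists[OF E(1) 4 E(3)])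
      fix S assume 1: "S \<subseteq> E" "card S = r" "good S" "\<And>H. H \<in> \<H> \<Longrightarrow> card (E - S) \<le> r * card (E - S - H)"
      have "finite S" using 1 E finite_subset by auto
      then have card: "card (E - S) = card E - r" using 1 by (simp add: card_Diff_subset)
      then have less: "card (E - S) < card E" "r \<le> card (E - S)" using 4 r_ge2 by linarith+
      obtain es where es: "distinct es" "set es = E - S" "cyc_good es"
        using less.hyps[OF less(1) _ less(2) 1(4)] E(1) by blast
      have "length es = card E - r" using es card distinct_card by metis
      moreover have "S \<union> set es = E" using es 1 by auto
      ultimately show ?thesis
        using cyc_good_add_basis[of S es] 1(2,3) es(1,2) two 4 r_ge2 lin_good_rotate[OF es(3)] by auto
    next
      fix S H assume 2: "S \<subseteq> E" "card S = r" "good S" "card (E - S) = r + 1"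
        "H \<in> \<H>" "card ((E - S) \<inter> H) = r" "card (S \<inter> H) + 2 \<le> r"
      let ?D = "(E - S) \<inter> H"
      have "card (E - S - ?D) = 1" using 2 E by (subst card_Diff_subset) auto
      then obtain z where z: "E - S - ?D = {z}" by (auto simp: card_1_singleton_iff)
      then have eq: "insert z ?D = E - S" "z \<notin> H" by auto
      have "\<exists>xs. distinct xs \<and> set xs = S \<union> insert z ?D \<and> cyc_good xs"
        using 2 eq by (intro cyc_good_two_basis_plus_one[of S z ?D H]) auto
      then show ?thesis using eq 2 by (simp add: Un_absorb1)
    qed
  qed
qed

end

section \<open>Paving matroids\<close>

locale paving_matroid =
  fixes E :: "'a set" and indep :: "'a set \<Rightarrow> bool"
  assumes matroid: "matroid E indep" and paving: "paving E indep"
begin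

abbreviation rk :: nat where "rk \<equiv> mrank indep E"

lemma finite_E: "finite E" and indep_subset: "indep X \<Longrightarrow> X \<subseteq> E" and indep_empty: "indep {}"
  using matroid by (auto simp: matroid_def)

lemma augment:
  assumes "indep X" "indep Y" "card X < card Y"
  obtains y where "y \<in> Y - X" "indep (insert y X)"
proof -
  have "\<exists>y\<in>Y - X. indep (insert y X)" using matroid assms by (simp add: matroid_def)
  then show ?thesis using that by blast
qed

lemma finite_indep_cards: "finite {card I | I. I \<subseteq> X \<and> indep I}"
  by (rule finite_subset[of _ "card ` Pow E"]) (use finite_E indep_subset in auto)

lemma card_le_mrank: "I \<subseteq> X \<Longrightarrow> indep I \<Longrightarrow> card I \<le> mrank indep X"
  unfolding mrank_def using finite_indep_cards by (intro Max_ge) auto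

lemma mrank_attained: obtains I where "I \<subseteq> X" "indep I" "card I = mrank indep X"
proof -
  have "mrank indep X \<in> {card I | I. I \<subseteq> X \<and> indep I}"
    unfolding mrank_def using finite_indep_cards indep_empty by (intro Max_in) auto
  then show ?thesis using that by auto
qed

lemma basisI:
  assumes "indep B" "card B = rk" shows "basis indep B"
  unfolding basis_def
proof (intro conjI allI impI)
  fix B' assume B': "indep B' \<and> B \<subseteq> B'"
  then have "card B' \<le> card B" using card_le_mrank[of B' E] indep_subset assms by auto
  then show "B' = B" using B' indep_subset finite_E finite_subset card_seteq by metis
qed (use assms in simp)

text \<open>A dependent subset of \<open>X\<close> of least cardinality is a circuit, and paving
  makes it too large to fit.\<close>

lemma indep_if_card_less:
  assumes "X \<subseteq> E" "card X < rk" shows "indep X"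
proof (rule ccontr)
  assume "\<not> indep X"
  then obtain C where C: "C \<subseteq> X \<and> \<not> indep C" and min: "\<forall>D. D \<subseteq> X \<and> \<not> indep D \<longrightarrow> card C \<le> card D"
    using ex_has_least_nat[of "\<lambda>C. C \<subseteq> X \<and> \<not> indep C" X card] by auto
  have fX: "finite X" using assms finite_E finite_subset by auto
  have "circuit E indep C"
    unfolding circuit_def
  proof (intro conjI allI impI)
    fix D assume D: "D \<subset> C"
    then have "card D < card C" using fX C finite_subset psubset_card_mono by metis
    then show "indep D" using min D C by (meson not_le psubset_imp_subset subset_trans)
  qed (use C assms in auto)
  then have "rk \<le> card C" using paving by (simp add: paving_def)
  also have "card C \<le> card X" using C fX by (simp add: card_mono)
  finally show False using assms by simp
qed

section \<open>Hyperplanes of a paving matroid\<close>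

text \<open>Rank below \<open>rk\<close>, phrased by independent subsets instead of the maximum in
  \<open>mrank\<close>.\<close>

definition nonspanning :: "'a set \<Rightarrow> bool" where
  "nonspanning X \<longleftrightarrow> X \<subseteq> E \<and> (\<forall>I\<subseteq>X. indep I \<longrightarrow> card I < rk)"

definition hyps :: "'a set set" where
  "hyps = {H. nonspanning H \<and> (\<forall>K. nonspanning K \<and> H \<subseteq> K \<longrightarrow> H = K)}"

lemma nonspanning_subset_hyp:
  assumes "nonspanning X" obtains H where "H \<in> hyps" "X \<subseteq> H"
proof -
  have "finite {K. nonspanning K}"
    by (rule finite_subset[of _ "Pow E"]) (use finite_E in \<open>auto simp: nonspanning_def\<close>)
  then obtain H where "nonspanning H" "X \<subseteq> H" "\<forall>K. nonspanning K \<longrightarrow> H \<subseteq> K \<longrightarrow> H = K"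
    using finite_has_maximal2[of "{K. nonspanning K}" X] assms by auto
  then show ?thesis by (intro that[of H]) (auto simp: hyps_def)
qed

text \<open>Some \<open>rk - 1\<close> elements of \<open>A\<close> are independent by paving. If
  the union of \<open>H\<close> and \<open>H'\<close> spanned, augmenting them would give
  \<open>rk\<close> independent elements inside \<open>H\<close> or \<open>H'\<close>; so the union
  is nonspanning and maximality applies.\<close>

lemma hyps_eqI:
  assumes H: "H \<in> hyps" "H' \<in> hyps" and A: "A \<subseteq> H" "A \<subseteq> H'" "rk \<le> Suc (card A)" and "2 \<le> rk"
  shows "H = H'"
proof -
  have nH: "nonspanning H" "nonspanning H'" using H by (auto simp: hyps_def)
  have "rk - 1 \<le> card A" using A by simp
  then obtain A' where A': "A' \<subseteq> A" "card A' = rk - 1" "finite A'" by (rule obtain_subset_with_card_n)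
  have "indep A'" using A' A nH \<open>2 \<le> rk\<close> by (intro indep_if_card_less) (auto simp: nonspanning_def)
  have "nonspanning (H \<union> H')"
    unfolding nonspanning_def
  proof (intro conjI allI impI)
    fix I assume I: "I \<subseteq> H \<union> H'" "indep I"
    show "card I < rk"
    proof (rule ccontr)
      assume "\<not> card I < rk"
      then have "card A' < card I" using A' \<open>2 \<le> rk\<close> by simp
      then obtain y where y: "y \<in> I - A'" "indep (insert y A')" using \<open>indep A'\<close> I(2) augment by blast
      have "insert y A' \<subseteq> H \<or> insert y A' \<subseteq> H'" using y I A A' by auto
      moreover have "card (insert y A') = rk" using y A' \<open>2 \<le> rk\<close> by simp
      ultimately show False using nH y(2) unfolding nonspanning_def by (metis less_irrefl)
    qed
  qed (use nH in \<open>auto simp: nonspanning_def\<close>)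
  then have "H = H \<union> H'" "H' = H \<union> H'" using H by (auto simp: hyps_def)
  then show ?thesis by simp
qed

section \<open>From the density condition to a cyclic ordering\<close>

lemma beta_le:
  assumes "gamma E indep = beta indep E" "X \<noteq> {}" "X \<subseteq> E"
  shows "beta indep X \<le> beta indep E"
proof -
  have "finite {beta indep X | X. X \<noteq> {} \<and> X \<subseteq> E}"
    by (rule finite_subset[of _ "beta indep ` Pow E"]) (use finite_E in auto)
  then have "beta indep X \<le> gamma E indep"
    unfolding gamma_def using assms by (intro Max_ge) auto
  then show ?thesis using assms by simp
qed

text \<open>\<open>H\<close> has rank at most \<open>rk - 1\<close>, so comparing
  \<open>beta\<close> of \<open>H\<close> and \<open>E\<close> gives
  \<open>rk * card H \<le> (rk - 1) * card E\<close>, which is rearranged.\<close>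

lemma nonspanning_density:
  assumes gamma: "gamma E indep = beta indep E" and H: "nonspanning H" and rk: "0 < rk"
  shows "card E \<le> rk * card (E - H)"
proof (cases "H = {}")
  case True
  then show ?thesis using rk by simp
next
  case False
  have HE: "H \<subseteq> E" using H by (simp add: nonspanning_def)
  have le: "beta indep H \<le> beta indep E" using beta_le gamma False HE by blast
  \<comment> \<open>Rank 0 would make \<open>beta indep H\<close> infinite, while
    \<open>beta indep E\<close> is finite.\<close>
  have r0: "mrank indep H \<noteq> 0" using le rk by (auto simp: beta_def split: if_splits)
  obtain I where "I \<subseteq> H" "indep I" "card I = mrank indep H" by (rule mrank_attained)
  then have "mrank indep H < rk" using H by (metis nonspanning_def)
  then have "mrank indep H \<le> rk - 1" using rk by simp
  have "real (card H) / real (mrank indep H) \<le> real (card E) / real rk"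
    using le r0 rk by (simp add: beta_def)
  then have "real (rk * card H) \<le> real (card E * mrank indep H)"
    using r0 rk by (simp add: field_simps)
  then have "rk * card H \<le> card E * mrank indep H" by (simp only: of_nat_le_iff)
  also have "\<dots> \<le> card E * (rk - 1)" using \<open>mrank indep H \<le> rk - 1\<close> by simp
  finally have "rk * card H + card E \<le> rk * card E" using rk by (cases rk) (simp_all add: mult.commute)
  moreover have "card (E - H) = card E - card H" using HE finite_E finite_subset by (metis card_Diff_subset)
  moreover have "card H \<le> card E" using HE finite_E by (simp add: card_mono)
  ultimately show ?thesis by (simp add: diff_mult_distrib2)
qed

lemma cyclically_orderableI:
  assumes xs: "distinct xs" "set xs = E"
    and bases: "\<And>i. i < length xs \<Longrightarrow> basis indep (set (take rk (drop i (xs @ xs))))"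
  shows "cyclically_orderable E indep"
  unfolding cyclically_orderable_def
proof (intro exI conjI allI impI)
  have len: "length xs = card E" using xs distinct_card by metis
  show "bij_betw ((!) xs) {0..<card E} E" using xs len by (intro bij_betw_nth) auto
  obtain B where "B \<subseteq> E" "card B = rk" using mrank_attained by blast
  then have "rk \<le> card E" using finite_E card_mono by metis
  fix i assume i: "i < card E"
  have "(\<lambda>j. xs ! ((i + j) mod card E)) ` {0..<rk} = set (take rk (drop i (xs @ xs)))"
    using i len \<open>rk \<le> card E\<close> by (subst take_drop_double) auto
  then show "basis indep ((\<lambda>j. xs ! ((i + j) mod card E)) ` {0..<rk})" using bases i len by simp
qed

lemma cyclically_orderable_if_uniformly_dense:
  assumes gamma: "gamma E indep = beta indep E"
  shows "cyclically_orderable E indep"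
proof (cases "2 \<le> rk")
  case True
  interpret hyperplanes hyps rk
    using True hyps_eqI by unfold_locales auto
  obtain B where "B \<subseteq> E" "card B = rk" using mrank_attained by blast
  then have "rk \<le> card E" using finite_E card_mono by metis
  moreover have "card E \<le> rk * card (E - H)" if "H \<in> hyps" for H
    using that True by (intro nonspanning_density gamma) (auto simp: hyps_def)
  ultimately obtain xs where xs: "distinct xs" "set xs = E" "cyc_good xs"
    using cyc_good_ordering_exists finite_E by blast
  show ?thesis
  proof (rule cyclically_orderableI[OF xs(1,2)])
    fix i assume i: "i < length xs"
    let ?W = "set (take rk (drop i (xs @ xs)))"
    have "good ?W" using xs(3) i by (simp add: cyc_good_def)
    then have "\<not> nonspanning ?W" using nonspanning_subset_hyp goodD by blast
    moreover have "?W \<subseteq> E" using xs(2) by (auto dest!: in_set_takeD in_set_dropD)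
    ultimately obtain I where I: "I \<subseteq> ?W" "indep I" "rk \<le> card I" by (auto simp: nonspanning_def not_less)
    \<comment> \<open>The window contains \<open>rk\<close> independent elements and has room for no
      others.\<close>
    have "card ?W \<le> rk" by (rule order_trans[OF card_length]) simp
    then have "I = ?W" using I by (intro card_seteq) auto
    moreover have "card I \<le> rk" using I indep_subset by (intro card_le_mrank) auto
    ultimately show "basis indep ?W" using I by (intro basisI) auto
  qed
next
  case False
  obtain xs where xs: "set xs = E" "distinct xs" using finite_distinct_list finite_E by blast
  show ?thesis
  proof (rule cyclically_orderableI[OF xs(2,1)])
    fix i assume i: "i < length xs"
    consider "rk = 0" | "rk = 1" using False by linarith
    then show "basis indep (set (take rk (drop i (xs @ xs))))"
    proof cases
      case 1
      then show ?thesis using indep_empty by (intro basisI) auto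
    next
      case 2
      have eq: "set (take rk (drop i (xs @ xs))) = {xs ! i}"
        using i 2 by (subst take_drop_double) auto
      have e: "xs ! i \<in> E" using xs i nth_mem by blast
      \<comment> \<open>A loop would have infinite \<open>beta\<close>, so in rank 1 every single
        element is a basis.\<close>
      then have "beta indep {xs ! i} \<le> beta indep E" using beta_le[OF gamma] by simp
      then have "mrank indep {xs ! i} \<noteq> 0" using 2 by (auto simp: beta_def split: if_splits)
      then obtain I where I: "I \<subseteq> {xs ! i}" "indep I" "card I \<noteq> 0" using mrank_attained by metis
      then have "I = {xs ! i}" by (auto simp: subset_singleton_iff)
      then show ?thesis using I 2 eq by (intro basisI) auto
    qed
  qed
qed

end

theorem theorem1:
  fixes E :: "'a set" and indep :: "'a set \<Rightarrow> bool"
  assumes "matroid E indep"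
    and "paving E indep"
    and "gamma E indep = beta indep E"
  shows "cyclically_orderable E indep"
proof -
  interpret paving_matroid E indep using assms by unfold_locales
  show ?thesis using cyclically_orderable_if_uniformly_dense assms(3) .
qed

end
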